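(* Let $f\neq 0$ be a non-negative function on the vertex set of a $(k,l)$-bi-regular tree. Let $\alpha(f)$ and $\beta(f)$ be the exponential growth rates of the sums of $f$ over endpoints of non-backtracking walks and of all walks, respectively, as defined in the context. Then $$\beta(f)=\begin{cases}\sqrt{k-1}+\sqrt{l-1} & \text{if } \alpha(f)\le (k-1)^{1/4}(l-1)^{1/4},\\[4pt] \left(\alpha(f)+\dfrac{k-1}{\alpha(f)}\right)^{1/2}\left(\alpha(f)+\dfrac{l-1}{\alpha(f)}\right)^{1/2} & \text{if } \alpha(f)\ge (k-1)^{1/4}(l-1)^{1/4}.\end{cases}$$
   Context: A $(k,l)$-bi-regular tree is a tree $G=(V,E)$ whose vertex set is a disjoint union $V=U\sqcup W$ such that every edge joins a vertex of $U$ to a vertex of $W$, every vertex of $U$ has degree $k$ and every vertex of $W$ has degree $l$. Fix a vertex $v\in V$. A walk of length $r$ from $v$ is a sequence of $r$ consecutive edge traversals starting at $v$; it is non-backtracking if no edge traversal is immediately followed by the traversal of the same edge in the opposite direction. Write $\mathrm{end}(p)$ for the final vertex of a walk $p$. For non-zero $f:V\to\mathbb{R}_{\ge 0}$ and $r\in\mathbb{N}$ put $$a_r(f)=\sum_{p} f(\mathrm{end}(p)) \quad\text{(sum over non-backtracking walks } p \text{ from } v \text{ of length } r),$$ $$b_r(f)=\sum_{p} f(\mathrm{end}(p)) \quad\text{(sum over all walks } p \text{ from } v \text{ of length } r),$$ and $$\alpha(f)=\limsup_{r\to\infty}a_r(f)^{1/r},\qquad \beta(f)=\limsup_{r\to\infty}b_r(f)^{1/r}.$$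 The values $\alpha(f)$ and $\beta(f)$ do not depend on the choice of $v$.
   Formalization: The formal theorem assumes k, l ≥ 2; for k = 1 or l = 1 the tree is a finite star, where α(f) = 0 and β(f) = √max(k,l) while the formula would give √(max(k,l) − 1), so the claim fails there. *)

theory Defs
  imports "Graph_Theory.Graph_Theory" "HOL-Library.Extended_Real" "HOL-Library.Liminf_Limsup"
begin

text \<open>
  An undirected simple graph, possibly infinite, is a symmetric loop-free digraph whose arcs are
  ordered pairs of vertices, so that the arcs \<open>(x, y)\<close> and \<open>(y, x)\<close> are the two traversals of one
  edge. The predicate \<^const>\<open>tree\<close> does not fit this encoding: it counts \<open>(x, y), (y, x)\<close> as a
  cycle. Cycles of the undirected graph are the cycles of length at least 3.
\<close>

definition undirected_tree :: "'a pair_pre_digraph \<Rightarrow> bool" where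
  "undirected_tree G \<longleftrightarrow>
     pair_bidirected_digraph G \<and>
     Digraph_Component.connected (with_proj G) \<and>
     \<not> (\<exists>p. pre_digraph.cycle (with_proj G) p \<and> 3 \<le> length p)"

text \<open>
  By symmetry the out-degree of a vertex is its degree in the undirected graph. For
  \<open>k, l > 0\<close> the degree conditions also say that \<open>G\<close> is locally finite, since the cardinality
  of an infinite set is 0.
\<close>

definition biregular_tree :: "nat \<Rightarrow> nat \<Rightarrow> 'a pair_pre_digraph \<Rightarrow> bool" where
  "biregular_tree k l G \<longleftrightarrow>
     undirected_tree G \<and>
     (\<exists>U W. pverts G = U \<union> W \<and> U \<inter> W = {} \<and>
        (\<forall>(x, y) \<in> parcs G. x \<in> U \<and> y \<in> W \<or> x \<in> W \<and> y \<in> U) \<and>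
        (\<forall>x\<in>U. out_degree (with_proj G) x = k) \<and>
        (\<forall>x\<in>W. out_degree (with_proj G) x = l))"

definition walks_from :: "'a pair_pre_digraph \<Rightarrow> 'a \<Rightarrow> nat \<Rightarrow> ('a \<times> 'a) awalk set" where
  "walks_from G v r = {p. (\<exists>w. pre_digraph.awalk (with_proj G) v p w) \<and> length p = r}"

definition non_backtracking :: "('a \<times> 'a) awalk \<Rightarrow> bool" where
  "non_backtracking p \<longleftrightarrow> (\<forall>i. Suc i < length p \<longrightarrow> p ! Suc i \<noteq> prod.swap (p ! i))"

definition nb_sum :: "'a pair_pre_digraph \<Rightarrow> 'a \<Rightarrow> ('a \<Rightarrow> real) \<Rightarrow> nat \<Rightarrow> real" where
  "nb_sum G v f r =
     (\<Sum>p \<in> {p \<in> walks_from G v r. non_backtracking p}. f (pre_digraph.awlast (with_proj G) v p))"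

definition walk_sum :: "'a pair_pre_digraph \<Rightarrow> 'a \<Rightarrow> ('a \<Rightarrow> real) \<Rightarrow> nat \<Rightarrow> real" where
  "walk_sum G v f r =
     (\<Sum>p \<in> walks_from G v r. f (pre_digraph.awlast (with_proj G) v p))"

text \<open>
  The growth rates lie in \<open>[0, \<infinity>]\<close>; the value \<open>\<infinity>\<close> occurs when \<open>f\<close> grows
  super-exponentially.
\<close>

definition nb_growth :: "'a pair_pre_digraph \<Rightarrow> 'a \<Rightarrow> ('a \<Rightarrow> real) \<Rightarrow> ereal" where
  "nb_growth G v f = limsup (\<lambda>r. ereal (root r (nb_sum G v f r)))"

definition walk_growth :: "'a pair_pre_digraph \<Rightarrow> 'a \<Rightarrow> ('a \<Rightarrow> real) \<Rightarrow> ereal" where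
  "walk_growth G v f = limsup (\<lambda>r. ereal (root r (walk_sum G v f r)))"

text \<open>The square root on \<open>[0, \<infinity>]\<close>; its value at \<open>-\<infinity>\<close> is immaterial.\<close>

fun ereal_sqrt :: "ereal \<Rightarrow> ereal" where
  "ereal_sqrt (ereal x) = ereal (sqrt x)"
| "ereal_sqrt PInfty = PInfty"
| "ereal_sqrt MInfty = MInfty"

end

theory Submission
  imports Defs
begin

text \<open>
  Put \<open>p = k - 1\<close> and \<open>q = l - 1\<close>, let \<open>v\<close> lie on the side of degree \<open>k\<close>, let \<open>A\<close> be the
  adjacency operator, and let \<open>a f n\<close> be the sum of \<open>f\<close> over the ends of the non-backtracking
  walks of length \<open>n\<close> from \<open>v\<close>. Follow such a walk by one arbitrary step: either the result is a
  non-backtracking walk of length \<open>n + 1\<close>, or the step undoes the last one, and then it leads back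
  to the end of a non-backtracking walk of length \<open>n - 1\<close>. Each walk of length \<open>n - 1\<close> is reached
  as often as it can be extended. Hence \<open>a (A f) = T (a f)\<close> for the one-dimensional operator
  \<open>(T g) n = g (n + 1) + c n * g (n - 1)\<close>, where \<open>c 1 = k\<close> and from then on \<open>c\<close> alternates
  between \<open>q\<close> (even \<open>n\<close>) and \<open>p\<close> (odd \<open>n\<close>). The sum of \<open>f\<close> over all walks of length \<open>r\<close> is
  \<open>(A ^^ r) f v = (T ^^ r) (a f) 0\<close> (\<open>walk_sum_eq_iterate\<close>), so the theorem is a
  statement about \<open>T\<close> and a non-negative sequence \<open>a\<close> that is not identically zero
  (\<open>growth_radial_adj_iterates\<close>).

  Write \<open>rate x = sqrt ((x + p / x) * (x + q / x))\<close>. It is the eigenvalue of \<open>T\<close>, away from the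
  root, for sequences that on each parity class are multiples of \<open>x ^ n\<close>, and
  it is unchanged if \<open>x\<close> is replaced by \<open>sqrt (p * q) / x\<close>. Both bounds compare with
  supersolutions, that is, sequences \<open>g\<close> with \<open>T g \<le> s * g\<close> pointwise.

  Upper bound: for \<open>x > 1\<close> there is a positive supersolution \<open>h\<close> for \<open>rate x\<close> with
  \<open>x ^ n \<le> C * h n\<close> (\<open>supersolution_dominating_power\<close>). If \<open>a n\<close> grows more slowly than \<open>x ^ n\<close>,
  monotonicity of \<open>T\<close> bounds \<open>(T ^^ r) a 0\<close> by a multiple of \<open>rate x ^ r\<close>.

  Lower bound: if \<open>(T ^^ r) a 0\<close> grows more slowly than \<open>s ^ r\<close>, then the Green potential
  \<open>\<Sum>r. (T ^^ r) a n / s ^ r\<close> converges for every \<open>n\<close> and is a supersolution for \<open>s\<close> above \<open>a\<close>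
  (\<open>supersolution_of_growth_less\<close>). A non-negative supersolution that is not identically zero
  forces \<open>s \<ge> sqrt p + sqrt q\<close>, because below this value the recursion oscillates
  (\<open>supersolution_eigenvalue_ge\<close>). If \<open>s = rate x\<close> with \<open>x\<close> beyond the minimum point
  \<open>root 4 p * root 4 q\<close> of \<open>rate\<close>, the supersolution grows at most like \<open>x ^ n\<close>
  (\<open>supersolution_power_bound\<close>), and so does \<open>a\<close>. Continuity of \<open>rate\<close> turns these one-sided
  statements into the formula.
\<close>

section \<open>Exponential growth rates\<close>

definition growth :: "(nat \<Rightarrow> real) \<Rightarrow> ereal" where
  "growth a = limsup (\<lambda>n. ereal (root n (a n)))"

lemma growth_nonneg:
  assumes "\<And>n. 0 \<le> a n"
  shows "0 \<le> growth a"
  unfolding growth_def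
  by (rule le_Limsup) (use assms in \<open>auto simp: real_root_ge_zero\<close>)

lemma growth_less_imp_bounded:
  assumes "growth a < ereal x" and "0 < x"
  shows "\<exists>C>0. \<forall>n. a n \<le> C * x ^ n"
proof -
  have "\<forall>\<^sub>F n in sequentially. ereal (root n (a n)) < ereal x"
    using assms(1) unfolding growth_def by (rule Limsup_lessD)
  then obtain N where N: "\<And>n. n \<ge> N \<Longrightarrow> root n (a n) < x"
    by (auto simp: eventually_sequentially)
  have large: "a n \<le> x ^ n" if "n \<ge> Suc N" for n
  proof (cases "0 \<le> a n")
    case True
    have "a n = root n (a n) ^ n"
      using that True by simp
    also have "\<dots> \<le> x ^ n"
      using N[of n] that True by (intro power_mono) (auto simp: real_root_ge_zero)
    finally show ?thesis .
  next
    case False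
    then show ?thesis using assms(2) by (smt (verit) zero_less_power)
  qed
  define C where "C = 1 + (\<Sum>n\<le>N. \<bar>a n\<bar> / x ^ n)"
  have nn: "0 \<le> (\<Sum>n\<le>N. \<bar>a n\<bar> / x ^ n)"
    using assms(2) by (intro sum_nonneg) auto
  have "a n \<le> C * x ^ n" for n
  proof (cases "n \<le> N")
    case True
    have "\<bar>a n\<bar> / x ^ n \<le> (\<Sum>n\<le>N. \<bar>a n\<bar> / x ^ n)"
      using True assms(2) by (intro member_le_sum) auto
    then have "\<bar>a n\<bar> / x ^ n \<le> C" by (simp add: C_def)
    then show ?thesis using assms(2) by (simp add: field_simps)
  next
    case False
    then have "a n \<le> 1 * x ^ n" using large[of n] by simp
    also have "\<dots> \<le> C * x ^ n"
      using nn assms(2) by (intro mult_right_mono) (auto simp: C_def)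
    finally show ?thesis .
  qed
  moreover have "C > 0" using nn by (simp add: C_def)
  ultimately show ?thesis by blast
qed

lemma bounded_imp_growth_le:
  assumes "\<And>n. a n \<le> C * x ^ n" and "0 < C" and "0 < x"
  shows "growth a \<le> ereal x"
proof -
  have "(\<lambda>n. ereal (root n C * x)) \<longlonglongrightarrow> ereal (1 * x)"
    by (intro tendsto_intros LIMSEQ_root_const assms)
  then have lim: "limsup (\<lambda>n. ereal (root n C * x)) = ereal (1 * x)"
    by (intro lim_imp_Limsup) auto
  have "\<forall>\<^sub>F n in sequentially. ereal (root n (a n)) \<le> ereal (root n C * x)"
    using eventually_gt_at_top[of 0]
  proof eventually_elim
    case (elim n)
    have "root n (a n) \<le> root n (C * x ^ n)"
      using elim assms(1) by simp
    then show ?case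
      using elim assms(3) by (simp add: real_root_mult real_root_power_cancel)
  qed
  then have "growth a \<le> limsup (\<lambda>n. ereal (root n C * x))"
    unfolding growth_def by (rule Limsup_mono)
  with lim show ?thesis by simp
qed

section \<open>The radial adjacency operator\<close>

text \<open>
  The action of the adjacency operator on sums over non-backtracking walks from a vertex of
  degree \<open>p + 1\<close>, the other side having degree \<open>q + 1\<close>. The weight \<open>down_weight n\<close> is the
  number of one-step extensions of a non-backtracking walk of length \<open>n - 1\<close>; the exceptional
  value \<open>p + 1\<close> at \<open>n = 1\<close> occurs because the empty walk has no last step to avoid.
  At \<open>n = 0\<close> the weight \<open>0\<close> removes the term in which \<open>n - 1\<close> is truncated.
\<close>

locale radial =
  fixes p q :: real
  assumes p_ge_1: "1 \<le> p" and q_ge_1: "1 \<le> q"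
begin

definition down_weight :: "nat \<Rightarrow> real" where
  "down_weight n = (if n = 0 then 0 else if n = 1 then p + 1 else if odd n then p else q)"

definition radial_adj :: "(nat \<Rightarrow> real) \<Rightarrow> nat \<Rightarrow> real" where
  "radial_adj g n = g (Suc n) + down_weight n * g (n - 1)"

lemma down_weight_nonneg: "0 \<le> down_weight n"
  using p_ge_1 q_ge_1 by (auto simp: down_weight_def)

lemma radial_adj_mono:
  assumes "\<And>n. g n \<le> h n"
  shows "radial_adj g n \<le> radial_adj h n"
  unfolding radial_adj_def by (intro add_mono mult_left_mono assms down_weight_nonneg)

lemma radial_adj_cmult: "radial_adj (\<lambda>n. c * g n) n = c * radial_adj g n"
  by (simp add: radial_adj_def algebra_simps)

lemma radial_adj_zero: "radial_adj (\<lambda>n. 0) = (\<lambda>n. 0)"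
  by (simp add: radial_adj_def fun_eq_iff)

lemma radial_adj_nonneg:
  assumes "\<And>n. 0 \<le> g n"
  shows "0 \<le> radial_adj g n"
  unfolding radial_adj_def using assms down_weight_nonneg by simp

lemma funpow_radial_adj_nonneg:
  assumes "\<And>n. 0 \<le> g n"
  shows "0 \<le> (radial_adj ^^ r) g n"
  by (induction r arbitrary: n) (auto intro: assms radial_adj_nonneg)

lemma funpow_radial_adj_le:
  assumes le: "\<And>n. a n \<le> C * h n" and super: "\<And>n. radial_adj h n \<le> lam * h n"
    and "0 \<le> C" "0 \<le> lam"
  shows "(radial_adj ^^ r) a n \<le> C * lam ^ r * h n"
proof (induction r arbitrary: n)
  case 0
  then show ?case using le by simp
next
  case (Suc r)
  have "(radial_adj ^^ Suc r) a n = radial_adj ((radial_adj ^^ r) a) n" by simp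
  also have "\<dots> \<le> radial_adj (\<lambda>n. C * lam ^ r * h n) n" by (rule radial_adj_mono) (rule Suc.IH)
  also have "\<dots> = C * lam ^ r * radial_adj h n" by (rule radial_adj_cmult)
  also have "\<dots> \<le> C * lam ^ r * (lam * h n)"
    using assms by (intro mult_left_mono super) auto
  finally show ?case by (simp add: mult_ac)
qed

definition rate :: "real \<Rightarrow> real" where
  "rate x = sqrt ((x + p / x) * (x + q / x))"

lemma rate_pos: "0 < x \<Longrightarrow> 0 < rate x"
  unfolding rate_def using p_ge_1 q_ge_1
  by (simp add: add_pos_pos)

lemma rate_square:
  assumes "0 < x"
  shows "(rate x)\<^sup>2 = x\<^sup>2 + p * q / x\<^sup>2 + p + q"
proof -
  have "0 \<le> (x + p / x) * (x + q / x)"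
    using assms p_ge_1 q_ge_1 by simp
  then have "(rate x)\<^sup>2 = (x + p / x) * (x + q / x)" by (simp add: rate_def)
  also have "\<dots> = x\<^sup>2 + p * q / x\<^sup>2 + p + q"
    using assms by (simp add: field_simps power2_eq_square)
  finally show ?thesis .
qed

text \<open>
  Away from the root, \<open>x ^ n\<close> with suitable factors on the two parity classes is an eigenvector
  for \<open>rate x\<close>, and so is the solution with \<open>sqrt (p * q) / x\<close> in place of \<open>x\<close>. The first one
  alone may violate the inequality at the root, where the weight is \<open>p + 1\<close> instead of \<open>p\<close>. The
  second one satisfies it strictly at the root, so a large multiple of it repairs the first.
\<close>

lemma supersolution_dominating_power:
  assumes "1 < x"
  shows "\<exists>h C. 0 < C \<and> (\<forall>n. x ^ n \<le> C * h n) \<and> (\<forall>n. radial_adj h n \<le> rate x * h n)"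
proof -
  define X where "X = x\<^sup>2"
  define Y where "Y = p * q / X"
  define lam where "lam = rate x"
  have X1: "1 < X" using assms by (simp add: X_def one_less_power)
  have Y0: "0 < Y" using X1 p_ge_1 q_ge_1 by (simp add: Y_def)
  have XY: "X * Y = p * q" using X1 by (simp add: Y_def)
  have Ypq: "Y < p * q" using X1 p_ge_1 q_ge_1 by (simp add: Y_def field_simps)
  have lam0: "0 < lam" using assms by (simp add: lam_def rate_pos)
  have lam2: "lam * lam = X + Y + p + q"
    using rate_square[of x] assms by (simp add: lam_def X_def Y_def power2_eq_square)
  \<comment> \<open>The slack that the second solution has at the root, after elimination of \<open>h 1\<close>.\<close>
  define d where "d = lam * lam * p / (p + 1) - (Y + p)"
  have "p + 1 \<noteq> 0" using p_ge_1 by simp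
  then have "lam * lam * p / (p + 1) * (p + 1) = lam * lam * p"
    by (rule nonzero_eq_divide_eq[THEN iffD1, OF _ refl])
  then have "d * (p + 1) = lam * lam * p - (Y + p) * (p + 1)"
    unfolding d_def left_diff_distrib by (simp only:)
  also have "\<dots> = p * (X - 1) + (p * q - Y)" unfolding lam2 by (simp add: algebra_simps)
  finally have "0 < d * (p + 1)" using Ypq X1 p_ge_1 by (simp add: add_pos_pos)
  then have d0: "0 < d" using p_ge_1 by (simp add: zero_less_mult_iff)
  \<comment> \<open>So large that the slack absorbs the whole left-hand side \<open>X + p\<close> which the first solution
    contributes at the root.\<close>
  define B where "B = (X + p) / d"
  have B0: "0 < B" using d0 X1 p_ge_1 by (simp add: B_def)
  have Bd: "B * d = X + p" using d0 by (simp add: B_def)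
  define F where "F m = X ^ m + B * Y ^ m" for m :: nat
  have F_rec: "F (Suc (Suc m)) + p * q * F m = (X + Y) * F (Suc m)" for m
    unfolding F_def XY[symmetric] by (simp add: algebra_simps)
  have FX: "X ^ m \<le> F m" for m using B0 Y0 by (simp add: F_def)
  have F0: "0 < F m" for m using FX[of m] X1 by (smt (verit) zero_less_power)
  \<comment> \<open>On even positions \<open>h\<close> is the combined solution, rescaled at \<open>0\<close> so that the weight \<open>p + 1\<close>
    acts as \<open>p\<close> would on \<open>F 0\<close>. The odd values are chosen to make the eigenvalue equation hold
    there, which leaves only the even positions to be checked.\<close>
  define h where "h n = (if n = 0 then F 0 * p / (p + 1)
      else if even n then F (n div 2) else (F (Suc (n div 2)) + p * F (n div 2)) / lam)" for n
  have h_even: "h (2 * Suc m) = F (Suc m)" for m by (simp add: h_def)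
  have h_odd: "lam * h (2 * m + 1) = F (Suc m) + p * F m" for m
    using lam0 by (simp add: h_def)
  have h_zero: "(p + 1) * h 0 = p * F 0" using p_ge_1 by (simp add: h_def)
  have super_odd: "radial_adj h (2 * m + 1) = lam * h (2 * m + 1)" for m
  proof (cases m)
    case 0
    then show ?thesis
      using h_even[of 0] h_odd[of 0] h_zero by (simp add: radial_adj_def down_weight_def numeral_2_eq_2)
  next
    case (Suc k)
    then show ?thesis
      using h_even[of m] h_even[of k] h_odd[of m] by (simp add: radial_adj_def down_weight_def)
  qed
  have super_even: "radial_adj h (2 * Suc m) = lam * h (2 * Suc m)" for m
  proof -
    have "lam * radial_adj h (2 * Suc m) = lam * h (2 * Suc m + 1) + q * (lam * h (2 * m + 1))"
      by (simp add: radial_adj_def down_weight_def algebra_simps)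
    also have "\<dots> = F (Suc (Suc m)) + p * F (Suc m) + q * (F (Suc m) + p * F m)"
      by (simp only: h_odd)
    also have "\<dots> = lam * lam * F (Suc m)"
      using F_rec[of m] by (simp add: lam2 algebra_simps)
    also have "\<dots> = lam * (lam * h (2 * Suc m))" by (simp only: h_even mult.assoc)
    finally show ?thesis using lam0 by simp
  qed
  have super_zero: "radial_adj h 0 \<le> lam * h 0"
  proof -
    have "lam * radial_adj h 0 = F 1 + p * F 0" using h_odd[of 0] by (simp add: radial_adj_def down_weight_def)
    also have "\<dots> = X + p + B * (Y + p)" by (simp add: F_def algebra_simps)
    also have "\<dots> = B * (lam * lam * p / (p + 1))"
      unfolding Bd[symmetric] d_def by (simp add: algebra_simps)
    also have "\<dots> \<le> F 0 * (lam * lam * p / (p + 1))"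
      using p_ge_1 lam0 by (intro mult_right_mono) (auto simp: F_def)
    also have "\<dots> = lam * (lam * h 0)" by (simp add: h_def)
    finally show ?thesis using lam0 by simp
  qed
  have super: "radial_adj h n \<le> lam * h n" for n
  proof (cases "even n")
    case True
    then obtain m where "n = 2 * m" by blast
    then show ?thesis
      using super_zero super_even by (cases m) (auto simp del: mult_Suc_right)
  next
    case False
    then obtain m where "n = 2 * m + 1" by (elim oddE)
    then show ?thesis using super_odd[of m] by simp
  qed
  define C where "C = 2 + lam"
  have "x ^ n \<le> C * h n" for n
  proof (cases "even n")
    case True
    then obtain m where n: "n = 2 * m" by blast
    show ?thesis
    proof (cases m)
      case 0
      have "1 \<le> 2 * h 0"
        using p_ge_1 B0 by (simp add: h_def F_def field_simps add_increasing2)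
      also have "\<dots> \<le> C * h 0"
        using lam0 p_ge_1 F0[of 0] by (intro mult_right_mono) (auto simp: C_def h_def)
      finally show ?thesis using n 0 by simp
    next
      case (Suc k)
      have "x ^ n = X ^ m" using n by (simp add: X_def power_mult)
      also have "\<dots> \<le> F m" by (rule FX)
      also have "\<dots> \<le> C * F m" using lam0 F0[of m] by (simp add: C_def)
      also have "F m = h n" using n Suc h_even by simp
      finally show ?thesis .
    qed
  next
    case False
    then obtain m where n: "n = 2 * m + 1" by (elim oddE)
    have "x ^ n \<le> x * x ^ n" using assms by simp
    also have "\<dots> = X ^ Suc m" using n by (simp add: X_def power_mult power2_eq_square)
    also have "\<dots> \<le> F (Suc m)" by (rule FX)
    also have "\<dots> \<le> lam * h n" using p_ge_1 F0[of m] unfolding n h_odd by simp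
    also have "\<dots> \<le> C * h n"
      using lam0 p_ge_1 F0[of m] F0[of "Suc m"] h_odd[of m]
      by (intro mult_right_mono) (auto simp: C_def n h_def)
    finally show ?thesis .
  qed
  moreover have "0 < C" using lam0 by (simp add: C_def)
  ultimately show ?thesis using super unfolding lam_def by blast
qed

lemma growth_radial_adj_iterates_le:
  assumes "1 < x" and "growth a < ereal x"
  shows "growth (\<lambda>r. (radial_adj ^^ r) a 0) \<le> ereal (rate x)"
proof -
  obtain C where C: "0 < C" "\<And>n. a n \<le> C * x ^ n"
    using growth_less_imp_bounded[of a x] assms by auto
  obtain h D where D: "0 < D" "\<And>n. x ^ n \<le> D * h n" "\<And>n. radial_adj h n \<le> rate x * h n"
    using supersolution_dominating_power[OF assms(1)] by blast
  have lam: "0 < rate x" using assms by (simp add: rate_pos)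
  have le: "a n \<le> (C * D) * h n" for n
  proof -
    have "a n \<le> C * x ^ n" by (rule C)
    also have "\<dots> \<le> C * (D * h n)" using C D by (intro mult_left_mono) auto
    finally show ?thesis by simp
  qed
  have "0 < D * h 0" using D(2)[of 0] by simp
  then have h0: "0 < h 0" using D(1) by (simp add: zero_less_mult_iff)
  have "(radial_adj ^^ r) a 0 \<le> (C * D * h 0) * rate x ^ r" for r
    using funpow_radial_adj_le[OF le D(3), of r 0] C D lam by (simp add: mult_ac)
  then show ?thesis
    by (rule bounded_imp_growth_le) (use C D h0 lam in auto)
qed

text \<open>
  The Green potential \<open>g n = (\<Sum>r. (radial_adj ^^ r) a n / s ^ r)\<close> satisfies
  \<open>radial_adj g = s * (g - a)\<close> and \<open>g \<ge> a \<ge> 0\<close>. The hypothesis gives convergence at \<open>0\<close>; it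
  spreads to all \<open>n\<close> because \<open>(radial_adj ^^ r) a (n + 1) \<le> (radial_adj ^^ (r + 1)) a n\<close>.
\<close>

lemma supersolution_of_growth_less:
  assumes a: "\<And>n. 0 \<le> a n" and less: "growth (\<lambda>r. (radial_adj ^^ r) a 0) < ereal s"
  shows "\<exists>g. (\<forall>n. a n \<le> g n) \<and> (\<forall>n. radial_adj g n \<le> s * g n)"
proof -
  have "0 \<le> growth (\<lambda>r. (radial_adj ^^ r) a 0)"
    by (rule growth_nonneg) (simp add: a funpow_radial_adj_nonneg)
  then obtain s' where s': "growth (\<lambda>r. (radial_adj ^^ r) a 0) < ereal s'" "ereal s' < ereal s" "0 < ereal s'"
    using ereal_dense2[OF less] le_less_trans by blast
  then have s'0: "0 < s'" and s's: "s' < s" by auto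
  obtain C where C: "0 < C" "\<And>r. (radial_adj ^^ r) a 0 \<le> C * s' ^ r"
    using growth_less_imp_bounded[OF s'(1) s'0] by blast
  define u where "u n r = (radial_adj ^^ r) a n / s ^ r" for n r
  have u0: "0 \<le> u n r" for n r
    using s'0 s's a by (simp add: u_def funpow_radial_adj_nonneg)
  have summable: "summable (u n)" for n
  proof (induction n)
    case 0
    show ?case
    proof (rule summable_comparison_test)
      show "summable (\<lambda>r. C * (s' / s) ^ r)"
        using s'0 s's by (intro summable_mult summable_geometric) auto
      have "norm (u 0 r) \<le> C * (s' / s) ^ r" for r
        using C(2)[of r] s'0 s's funpow_radial_adj_nonneg[of a r 0, OF a]
        by (simp add: u_def power_divide divide_right_mono)
      then show "\<exists>N. \<forall>n\<ge>N. norm (u 0 n) \<le> C * (s' / s) ^ n" by blast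
    qed
  next
    case (Suc n)
    show ?case
    proof (rule summable_comparison_test)
      show "summable (\<lambda>r. s * u n (Suc r))"
        using Suc by (intro summable_mult) (simp add: summable_Suc_iff)
      have "(radial_adj ^^ r) a (Suc n) \<le> (radial_adj ^^ Suc r) a n" for r
        using down_weight_nonneg a by (simp add: radial_adj_def funpow_radial_adj_nonneg)
      then have "norm (u (Suc n) r) \<le> s * u n (Suc r)" for r
        using s'0 s's funpow_radial_adj_nonneg[of a r "Suc n", OF a] by (simp add: u_def divide_right_mono)
      then show "\<exists>N. \<forall>r\<ge>N. norm (u (Suc n) r) \<le> s * u n (Suc r)" by blast
    qed
  qed
  define g where "g n = suminf (u n)" for n
  have step: "radial_adj g n = s * (g n - a n)" for n
  proof -
    have "radial_adj g n = (\<Sum>r. u (Suc n) r + down_weight n * u (n - 1) r)"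
      unfolding radial_adj_def g_def using summable[of "Suc n"] summable[of "n - 1"]
      by (subst suminf_add[symmetric]) (auto intro: summable_mult simp: suminf_mult)
    also have "\<dots> = (\<Sum>r. s * u n (Suc r))"
    proof (rule arg_cong[where f = suminf], rule ext)
      fix r
      have "s * (z / (s * s ^ r)) = z / s ^ r" for z using s'0 s's by simp
      then show "u (Suc n) r + down_weight n * u (n - 1) r = s * u n (Suc r)"
        by (simp add: u_def radial_adj_def distrib_left add_divide_distrib)
    qed
    also have "\<dots> = s * (\<Sum>r. u n (Suc r))"
      using summable by (intro suminf_mult) (simp add: summable_Suc_iff)
    also have "(\<Sum>r. u n (Suc r)) = g n - a n"
      using suminf_split_head[OF summable[of n]] by (simp add: g_def u_def)
    finally show ?thesis .
  qed
  have "a n \<le> g n" for n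
  proof -
    have "u n 0 \<le> suminf (u n)"
      using sum_le_suminf[OF summable[of n], of "{0}"] u0 by auto
    then show ?thesis by (simp add: u_def g_def)
  qed
  moreover have "radial_adj g n \<le> s * g n" for n
    using s'0 s's a[of n] by (simp add: step algebra_simps)
  ultimately show ?thesis by blast
qed

text \<open>
  Eliminating the odd positions yields a recursive inequality with constant coefficients; the
  larger weight at \<open>n = 1\<close> only strengthens it. Its characteristic roots have product \<open>p * q\<close>
  and sum \<open>s\<^sup>2 - p - q\<close>, so they are \<open>x\<^sup>2\<close> and \<open>p * q / x\<^sup>2\<close> when \<open>s = rate x\<close>.
\<close>

lemma supersolution_two_step:
  assumes g: "\<And>n. 0 \<le> g n" and super: "\<And>n. radial_adj g n \<le> s * g n" and "0 < s"
  shows "g (2 * Suc (Suc m)) + p * q * g (2 * m) \<le> (s\<^sup>2 - p - q) * g (2 * Suc m)"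
proof -
  have even: "g (2 * m + 3) + q * g (2 * m + 1) \<le> s * g (2 * m + 2)"
    using super[of "2 * m + 2"] by (simp add: radial_adj_def down_weight_def numeral_3_eq_3)
  have odd: "g (2 * i + 2) + p * g (2 * i) \<le> s * g (2 * i + 1)" for i
    using super[of "2 * i + 1"] g[of "2 * i"]
    by (cases i) (auto simp: radial_adj_def down_weight_def algebra_simps)
  have "(g (2 * m + 4) + p * g (2 * m + 2)) + q * (g (2 * m + 2) + p * g (2 * m))
      \<le> s * g (2 * m + 3) + q * (s * g (2 * m + 1))"
    using odd[of "Suc m"] odd[of m] q_ge_1
    by (intro add_mono mult_left_mono) (auto simp: eval_nat_numeral)
  also have "\<dots> = s * (g (2 * m + 3) + q * g (2 * m + 1))" by (simp add: algebra_simps)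
  also have "\<dots> \<le> s * (s * g (2 * m + 2))" using even assms(3) by simp
  finally show ?thesis by (simp add: algebra_simps power2_eq_square eval_nat_numeral)
qed

text \<open>
  With characteristic roots \<open>X > Y\<close> of the two-step recursion for \<open>G m = g (2 * m)\<close>, the
  difference \<open>G (m + 1) - Y * G m\<close> grows at most by the factor \<open>X\<close> in each step, hence is at most
  \<open>D * X ^ m\<close>. This first-order recursion is dominated by \<open>X ^ m\<close>, since \<open>Y < X\<close>.
\<close>

lemma supersolution_power_bound:
  assumes g: "\<And>n. 0 \<le> g n" and super: "\<And>n. radial_adj g n \<le> rate x * g n"
    and "0 < x" and x: "p * q < x ^ 4"
  shows "growth g \<le> ereal x"
proof -
  define X where "X = x\<^sup>2"
  define Y where "Y = p * q / X"
  have X0: "0 < X" using assms by (simp add: X_def)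
  have lam0: "0 < rate x" using assms by (simp add: rate_pos)
  have Y0: "0 < Y" using X0 p_ge_1 q_ge_1 by (simp add: Y_def)
  have XY: "p * q = X * Y" using X0 by (simp add: Y_def)
  have "p * q < X * X" using x by (simp add: X_def power2_eq_square eval_nat_numeral mult_ac)
  then have YX: "Y < X" using X0 by (simp add: Y_def field_simps)
  define G where "G m = g (2 * m)" for m
  have "(rate x)\<^sup>2 - p - q = X + Y"
    using rate_square[of x] assms by (simp add: X_def Y_def)
  then have rec: "G (Suc (Suc m)) + X * Y * G m \<le> (X + Y) * G (Suc m)" for m
    using supersolution_two_step[OF g super lam0, of m] unfolding G_def XY by simp
  define D where "D = \<bar>G 1 - Y * G 0\<bar>"
  have first_order: "G (Suc m) - Y * G m \<le> D * X ^ m" for m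
  proof (induction m)
    case 0
    then show ?case by (simp add: D_def)
  next
    case (Suc m)
    have "G (Suc (Suc m)) - Y * G (Suc m) \<le> X * (G (Suc m) - Y * G m)"
      using rec[of m] by (simp add: algebra_simps)
    also have "\<dots> \<le> X * (D * X ^ m)" using Suc X0 by (intro mult_left_mono) auto
    finally show ?case by (simp add: mult_ac)
  qed
  define K where "K = 1 + G 0 + D / (X - Y)"
  have D0: "0 \<le> D" by (simp add: D_def)
  have G0: "0 \<le> G m" for m by (simp add: G_def g)
  have KD: "D \<le> (X - Y) * K"
  proof -
    have "(X - Y) * K = (X - Y) * (1 + G 0) + D" using YX unfolding K_def distrib_left by simp
    moreover have "0 \<le> (X - Y) * (1 + G 0)" using YX G0[of 0] by simp
    ultimately show ?thesis by simp
  qed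
  have K0: "0 < K" using YX D0 G0[of 0] unfolding K_def
    by (smt (verit) divide_nonneg_nonneg)
  have GK: "G m \<le> K * X ^ m" for m
  proof (induction m)
    case 0
    then show ?case using D0 YX by (simp add: K_def)
  next
    case (Suc m)
    have "G (Suc m) \<le> Y * G m + D * X ^ m" using first_order[of m] by simp
    also have "\<dots> \<le> Y * (K * X ^ m) + ((X - Y) * K) * X ^ m"
      using Suc KD Y0 X0 by (intro add_mono mult_left_mono mult_right_mono) auto
    finally show ?case by (simp add: algebra_simps)
  qed
  define C where "C = K * (1 + rate x / x)"
  have ratio0: "0 < rate x / x" using lam0 assms(3) by simp
  have C0: "0 < C" using K0 ratio0 by (simp add: C_def)
  have "g n \<le> C * x ^ n" for n
  proof (cases "even n")
    case True
    then obtain m where n: "n = 2 * m" by blast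
    have "g n \<le> K * x ^ n" using GK[of m] n by (simp add: G_def X_def power_mult)
    also have "\<dots> \<le> C * x ^ n"
      using K0 ratio0 assms(3) by (intro mult_right_mono) (auto simp: C_def)
    finally show ?thesis .
  next
    case False
    then obtain m where n: "n = 2 * m + 1" by (elim oddE)
    have "g n \<le> radial_adj g (2 * m)" using g down_weight_nonneg n by (simp add: radial_adj_def)
    also have "\<dots> \<le> rate x * G m" using super[of "2 * m"] by (simp add: G_def)
    also have "\<dots> \<le> rate x * (K * X ^ m)" using GK lam0 by (intro mult_left_mono) auto
    also have "\<dots> = K * (rate x / x) * x ^ n"
      using assms(3) n by (simp add: X_def power_mult)
    also have "\<dots> \<le> C * x ^ n"
      using K0 assms(3) by (intro mult_right_mono) (auto simp: C_def distrib_left)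
    finally show ?thesis .
  qed
  then show ?thesis by (rule bounded_imp_growth_le) (use C0 assms(3) in auto)
qed

text \<open>
  Each of \<open>g (n + 1)\<close> and \<open>g (n - 1)\<close> enters \<open>radial_adj g n\<close> with a positive weight, so a zero of
  \<open>g\<close> makes \<open>g\<close> vanish at the neighbouring positions; positivity at one position spreads to all.
\<close>

lemma supersolution_pos:
  assumes g: "\<And>n. 0 \<le> g n" and super: "\<And>n. radial_adj g n \<le> s * g n"
    and "0 < g m"
  shows "0 < g n"
proof -
  have upward: "0 < g (Suc n)" if "0 < g n" for n
  proof -
    have "0 < down_weight (Suc n) * g n"
      using that p_ge_1 q_ge_1 by (auto simp: down_weight_def)
    then have "0 < s * g (Suc n)"
      using super[of "Suc n"] g[of "Suc (Suc n)"] by (simp add: radial_adj_def)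
    then show ?thesis using g[of "Suc n"] by (cases "g (Suc n) = 0") auto
  qed
  have downward: "0 < g n" if "0 < g (Suc n)" for n
  proof -
    have "0 \<le> down_weight n * g (n - 1)" by (intro mult_nonneg_nonneg down_weight_nonneg g)
    then have "0 < s * g n"
      using super[of n] that unfolding radial_adj_def by linarith
    then show ?thesis using g[of n] by (cases "g n = 0") auto
  qed
  have "0 < g 0" using assms(3) by (induction m) (auto intro: downward)
  then show ?thesis by (induction n) (auto intro: upward)
qed

text \<open>
  Suppose \<open>s\<close> is smaller, that is, \<open>S = s\<^sup>2 - p - q < 2 * R\<close> with \<open>R = sqrt (p * q)\<close>. The ratios
  \<open>t m = g (2 * m + 2) / g (2 * m)\<close> satisfy \<open>t (m + 1) + R\<^sup>2 / t m \<le> S\<close>, whereas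
  \<open>t m + R\<^sup>2 / t m \<ge> 2 * R\<close>. So they drop by at least \<open>2 * R - S > 0\<close> in each step and cannot
  remain positive.
\<close>

lemma supersolution_eigenvalue_ge:
  assumes g: "\<And>n. 0 \<le> g n" and super: "\<And>n. radial_adj g n \<le> s * g n"
    and "0 < g m" and "0 < s"
  shows "sqrt p + sqrt q \<le> s"
proof (rule ccontr)
  assume "\<not> ?thesis"
  then have "s\<^sup>2 < (sqrt p + sqrt q)\<^sup>2" using assms(4) by (intro power_strict_mono) auto
  then have small: "s\<^sup>2 - p - q < 2 * (sqrt p * sqrt q)"
    using p_ge_1 q_ge_1 by (simp add: power2_sum)
  define R where "R = sqrt p * sqrt q"
  have RR: "R * R = p * q"
    using p_ge_1 q_ge_1 by (simp add: R_def mult_ac flip: power2_eq_square real_sqrt_mult)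
  define S where "S = s\<^sup>2 - p - q"
  define G where "G m = g (2 * m)" for m
  have G0: "0 < G m" for m using supersolution_pos[OF g super assms(3)] by (simp add: G_def)
  have rec: "G (Suc (Suc m)) + R * R * G m \<le> S * G (Suc m)" for m
    using supersolution_two_step[OF g super assms(4), of m] by (simp add: G_def S_def RR)
  define t where "t m = G (Suc m) / G m" for m
  have t0: "0 < t m" for m using G0 by (simp add: t_def)
  have drop: "t (Suc m) \<le> t m - (2 * R - S)" for m
  proof -
    have "t (Suc m) + R * R / t m = (G (Suc (Suc m)) + R * R * G m) / G (Suc m)"
      by (simp add: t_def add_divide_distrib)
    also have "\<dots> \<le> S" using rec[of m] G0[of "Suc m"] by (simp add: field_simps)
    finally have "t (Suc m) + R * R / t m \<le> S" .
    moreover have "2 * R \<le> t m + R * R / t m"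
    proof -
      have "0 \<le> (t m - R) * (t m - R)" by simp
      then have "2 * R * t m \<le> t m * t m + R * R" by (simp add: algebra_simps)
      then show ?thesis using t0[of m] by (simp add: field_simps)
    qed
    ultimately show ?thesis by simp
  qed
  have "t m \<le> t 0 - m * (2 * R - S)" for m
  proof (induction m)
    case (Suc m)
    then show ?case using drop[of m] by (simp add: algebra_simps)
  qed simp
  moreover obtain m :: nat where "t 0 < m * (2 * R - S)"
    using reals_Archimedean3[of "2 * R - S"] small by (auto simp: R_def S_def)
  ultimately show False using t0[of m] by (smt (verit))
qed

text \<open>
  The two cases are \<open>rate\<close> evaluated at the larger of \<open>\<alpha>\<close> and \<open>c = root 4 p * root 4 q\<close>, the
  minimum point of \<open>rate\<close>, where \<open>rate c = sqrt p + sqrt q\<close>. The strict inequalities in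
  the two comparison bounds are removed by letting \<open>x\<close> tend to its limiting value from above or
  from below; for \<open>\<alpha> = \<infinity>\<close> the bound \<open>rate x \<ge> x\<close> takes the place of continuity.
\<close>

theorem growth_radial_adj_iterates:
  fixes a :: "nat \<Rightarrow> real"
  assumes a: "\<And>n. 0 \<le> a n" and nonzero: "a m \<noteq> 0"
  defines "\<alpha> \<equiv> growth a" and "\<beta> \<equiv> growth (\<lambda>r. (radial_adj ^^ r) a 0)"
  shows "(\<alpha> \<le> ereal (root 4 p * root 4 q) \<longrightarrow> \<beta> = ereal (sqrt p + sqrt q)) \<and>
    (\<alpha> \<ge> ereal (root 4 p * root 4 q) \<longrightarrow>
      \<beta> = ereal_sqrt (\<alpha> + ereal p / \<alpha>) * ereal_sqrt (\<alpha> + ereal q / \<alpha>))"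
proof -
  define c where "c = root 4 p * root 4 q"
  have c1: "1 \<le> c"
    using p_ge_1 q_ge_1 mult_mono[of 1 "root 4 p" 1 "root 4 q"] by (simp add: c_def)
  have c4: "c ^ 4 = p * q"
    using p_ge_1 q_ge_1 by (simp add: c_def power_mult_distrib)
  have "(c\<^sup>2)\<^sup>2 = p * q" using c4 by (simp flip: power_mult)
  then have c2: "c\<^sup>2 = sqrt p * sqrt q"
    by (metis real_sqrt_mult real_sqrt_unique zero_le_power2)
  have rate_c: "rate c = sqrt p + sqrt q"
  proof (rule power2_eq_imp_eq)
    have "p * q / c\<^sup>2 = c\<^sup>2"
      using c4 c1 by (simp add: field_simps flip: power_add)
    then show "(rate c)\<^sup>2 = (sqrt p + sqrt q)\<^sup>2"
      using rate_square[of c] c1 c2 p_ge_1 q_ge_1 by (simp add: power2_sum)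
  qed (use c1 rate_pos[of c] p_ge_1 q_ge_1 in auto)
  have cont: "isCont rate x" if "0 < x" for x
    unfolding rate_def using that by (intro continuous_intros) auto
  have upper: "\<beta> \<le> ereal (rate x)" if "c \<le> x" "\<alpha> \<le> ereal x" for x
  proof (rule tendsto_lowerbound)
    show "((\<lambda>y. ereal (rate y)) \<longlongrightarrow> ereal (rate x)) (at_right x)"
      using cont[of x] that c1
      by (intro tendsto_intros) (auto simp: isCont_def intro: tendsto_mono[OF at_le])
    have "\<beta> \<le> ereal (rate y)" if y: "x < y" for y
      unfolding \<beta>_def
    proof (rule growth_radial_adj_iterates_le)
      show "1 < y" using y \<open>c \<le> x\<close> c1 by simp
      show "growth a < ereal y"
        using y \<open>\<alpha> \<le> ereal x\<close> by (auto simp: \<alpha>_def intro: le_less_trans)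
    qed
    then show "\<forall>\<^sub>F y in at_right x. \<beta> \<le> ereal (rate y)"
      by (auto simp: eventually_at_filter)
  qed simp
  have lower: "ereal (sqrt p + sqrt q) \<le> \<beta>"
  proof (rule ccontr)
    assume "\<not> ?thesis"
    then have "\<beta> < ereal (sqrt p + sqrt q)" by simp
    then obtain s where s: "\<beta> < ereal s" "s < sqrt p + sqrt q"
      using ereal_dense2 by (metis less_ereal.simps(1))
    obtain g where g: "\<And>n. a n \<le> g n" "\<And>n. radial_adj g n \<le> s * g n"
      using supersolution_of_growth_less[of a s, OF a] s(1) unfolding \<beta>_def by blast
    have "0 \<le> \<beta>" unfolding \<beta>_def by (rule growth_nonneg) (simp add: a funpow_radial_adj_nonneg)
    then have "0 < s" using s(1) by (auto dest: le_less_trans)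
    moreover have "0 < g m" using a[of m] nonzero g(1)[of m] by simp
    moreover have "0 \<le> g n" for n using a[of n] g(1)[of n] by simp
    ultimately show False using supersolution_eigenvalue_ge[of g s m] g(2) s(2) by force
  qed
  have lower_rate: "\<alpha> \<le> ereal x" if x: "c < x" "\<beta> < ereal (rate x)" for x
  proof -
    obtain g where g: "\<And>n. a n \<le> g n" "\<And>n. radial_adj g n \<le> rate x * g n"
      using supersolution_of_growth_less[of a "rate x", OF a] x(2) unfolding \<beta>_def by blast
    have x0: "0 < x" using x c1 by simp
    have "p * q < x ^ 4" using x c1 unfolding c4[symmetric] by (intro power_strict_mono) auto
    moreover have "0 \<le> g n" for n using a[of n] g(1)[of n] by simp
    ultimately have "growth g \<le> ereal x"
      by (intro supersolution_power_bound g(2) x0)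
    moreover have "\<alpha> \<le> growth g" unfolding \<alpha>_def growth_def
      by (intro Limsup_mono eventually_mono[OF eventually_gt_at_top[of 0]]) (simp add: g(1))
    ultimately show ?thesis by simp
  qed
  have first: "\<beta> = ereal (sqrt p + sqrt q)" if "\<alpha> \<le> ereal c"
    using upper[of c] lower that rate_c by simp
  have second: "\<beta> = ereal_sqrt (\<alpha> + ereal p / \<alpha>) * ereal_sqrt (\<alpha> + ereal q / \<alpha>)"
    if ge: "ereal c \<le> \<alpha>"
  proof (cases \<alpha>)
    case (real x)
    have cx: "c \<le> x" using ge real by simp
    have x0: "0 < x" using cx c1 by simp
    have "ereal (rate x) \<le> \<beta>"
    proof (cases "c = x")
      case True
      then show ?thesis using lower rate_c by simp
    next
      case False
      show ?thesis
      proof (rule tendsto_upperbound)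
        show "((\<lambda>y. ereal (rate y)) \<longlongrightarrow> ereal (rate x)) (at_left x)"
          using cont[of x] x0
          by (intro tendsto_intros) (auto simp: isCont_def intro: tendsto_mono[OF at_le])
        have "ereal (rate y) \<le> \<beta>" if "c < y" "y < x" for y
          using lower_rate[of y] that real by force
        then show "\<forall>\<^sub>F y in at_left x. ereal (rate y) \<le> \<beta>"
          using False cx by (intro eventually_at_leftI[of c]) auto
      qed simp
    qed
    then have "\<beta> = ereal (rate x)" using upper[of x] cx real by simp
    then show ?thesis using real x0 by (simp add: rate_def real_sqrt_mult)
  next
    case PInf
    have "\<beta> = \<infinity>"
    proof (rule ccontr)
      assume "\<beta> \<noteq> \<infinity>"
      then obtain B where B: "\<beta> \<le> ereal B" by (cases \<beta>) auto
      define x where "x = max (c + 1) (B + 1)"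
      have cx: "c < x" by (simp add: x_def)
      have x0: "0 < x" using cx c1 by simp
      have "x\<^sup>2 \<le> (rate x)\<^sup>2"
        using p_ge_1 q_ge_1 by (simp add: rate_square x0)
      then have "x \<le> rate x" using rate_pos[of x] x0 by (simp add: abs_le_square_iff[symmetric])
      then have "B < rate x" by (simp add: x_def)
      then have "\<beta> < ereal (rate x)" using B by (auto intro: le_less_trans)
      then show False using lower_rate[OF cx] PInf by simp
    qed
    then show ?thesis using PInf
      by (simp add: infinity_ereal_def[symmetric] ereal_sqrt.simps(2)[folded infinity_ereal_def])
  next
    case MInf
    then show ?thesis using ge by simp
  qed
  show ?thesis using first second unfolding c_def by blast
qed

end

section \<open>Walks in locally finite graphs\<close>

locale locally_finite_graph = pair_bidirected_digraph +
  assumes finite_out_arcs: "\<And>x. x \<in> pverts G \<Longrightarrow> finite (out_arcs G x)"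
begin

abbreviation walk_end :: "'a \<Rightarrow> ('a \<times> 'a) awalk \<Rightarrow> 'a" where
  "walk_end v p \<equiv> last (pawalk_verts v p)"

definition adj :: "('a \<Rightarrow> real) \<Rightarrow> 'a \<Rightarrow> real" where
  "adj f x = (\<Sum>e \<in> out_arcs G x. f (snd e))"

lemma swap_arc: "e \<in> parcs G \<Longrightarrow> prod.swap e \<in> parcs G"
  using pair_sym_arcs unfolding symmetric_def by (cases e) (auto elim: symE)

definition nb_walks :: "'a \<Rightarrow> nat \<Rightarrow> ('a \<times> 'a) awalk set" where
  "nb_walks v n = {p \<in> walks_from G v n. non_backtracking p}"

definition nb_exts :: "'a \<Rightarrow> ('a \<times> 'a) awalk \<Rightarrow> ('a \<times> 'a) set" where
  "nb_exts v p = {e \<in> out_arcs G (walk_end v p). p \<noteq> [] \<longrightarrow> e \<noteq> prod.swap (last p)}"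

lemma walks_from_0: "v \<in> pverts G \<Longrightarrow> walks_from G v 0 = {[]}"
  by (auto simp: walks_from_def awalk_def)

lemma walk_end_snoc: "walk_end v (p @ [e]) = snd e"
  by (induction p arbitrary: v) auto

lemma walk_end_in_pverts:
  "p \<in> walks_from G v n \<Longrightarrow> walk_end v p \<in> pverts G"
  by (auto simp: walks_from_def awalk_def intro!: awlast_in_verts)

lemma snoc_in_walks_from:
  "p @ [e] \<in> walks_from G v (Suc n) \<longleftrightarrow> p \<in> walks_from G v n \<and> e \<in> out_arcs G (walk_end v p)"
proof -
  have "awalk v (p @ [e]) w \<longleftrightarrow> awalk v p (walk_end v p) \<and> awalk (walk_end v p) [e] w" for w
    by (rule awalk_append_iff)
  moreover have "awalk x [e] w \<longleftrightarrow> e \<in> out_arcs G x \<and> w = snd e" for x w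
    using arc_fst_in_verts[of e] arc_snd_in_verts[of e] by (auto simp: awalk_simps)
  moreover have "(\<exists>w. awalk v p w) \<longleftrightarrow> awalk v p (walk_end v p)"
    by auto
  ultimately have "(\<exists>w. awalk v (p @ [e]) w) \<longleftrightarrow>
      (\<exists>w. awalk v p w) \<and> e \<in> out_arcs G (walk_end v p)"
    by metis
  then show ?thesis unfolding walks_from_def mem_Collect_eq length_append_singleton by blast
qed

lemma walks_from_Suc:
  "walks_from G v (Suc n) =
    (\<lambda>(p, e). p @ [e]) ` (SIGMA p : walks_from G v n. out_arcs G (walk_end v p))"
proof (intro equalityI subsetI)
  fix p' assume p': "p' \<in> walks_from G v (Suc n)"
  then have "p' \<noteq> []" by (auto simp: walks_from_def)
  then obtain p e where "p' = p @ [e]" by (cases p' rule: rev_cases) auto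
  with p' show "p' \<in> (\<lambda>(p, e). p @ [e]) ` (SIGMA p : walks_from G v n. out_arcs G (walk_end v p))"
    by (auto simp: snoc_in_walks_from)
qed (auto simp: snoc_in_walks_from)

lemma non_backtracking_snoc:
  "non_backtracking (p @ [e]) \<longleftrightarrow>
    non_backtracking p \<and> (p \<noteq> [] \<longrightarrow> e \<noteq> prod.swap (last p))"
proof -
  have "non_backtracking (p @ [e]) \<longleftrightarrow>
      (\<forall>i. Suc i < length p \<longrightarrow> p ! Suc i \<noteq> prod.swap (p ! i)) \<and>
      (\<forall>i. Suc i = length p \<longrightarrow> e \<noteq> prod.swap (p ! i))"
    unfolding non_backtracking_def by (auto simp: nth_append less_Suc_eq)
  then show ?thesis
    unfolding non_backtracking_def by (cases p rule: rev_cases) (auto simp: nth_append)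
qed

lemma nb_walks_Suc:
  "nb_walks v (Suc n) = (\<lambda>(p, e). p @ [e]) ` (SIGMA p : nb_walks v n. nb_exts v p)"
proof -
  have "nb_walks v (Suc n) = (\<lambda>(p, e). p @ [e]) `
      {(p, e) \<in> (SIGMA p : walks_from G v n. out_arcs G (walk_end v p)). non_backtracking (p @ [e])}"
    unfolding nb_walks_def walks_from_Suc by auto
  also have "{(p, e) \<in> (SIGMA p : walks_from G v n. out_arcs G (walk_end v p)).
      non_backtracking (p @ [e])} = (SIGMA p : nb_walks v n. nb_exts v p)"
    unfolding non_backtracking_snoc nb_walks_def nb_exts_def by auto
  finally show ?thesis .
qed

lemma nb_walks_0: "v \<in> pverts G \<Longrightarrow> nb_walks v 0 = {[]}"
  by (auto simp: nb_walks_def walks_from_0 non_backtracking_def)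

lemma inj_on_snoc: "inj_on (\<lambda>(p, e). p @ [e]) A"
  by (auto simp: inj_on_def)

lemma finite_walks_from: "v \<in> pverts G \<Longrightarrow> finite (walks_from G v n)"
  by (induction n)
    (auto simp: walks_from_0 walks_from_Suc intro!: finite_imageI finite_SigmaI finite_out_arcs
      walk_end_in_pverts)

lemma finite_nb_walks: "v \<in> pverts G \<Longrightarrow> finite (nb_walks v n)"
  by (simp add: nb_walks_def finite_walks_from)

lemma finite_nb_exts: "p \<in> nb_walks v n \<Longrightarrow> finite (nb_exts v p)"
  by (rule finite_subset[OF _ finite_out_arcs[OF walk_end_in_pverts[of p v n]]])
    (auto simp: nb_walks_def nb_exts_def)

lemma sum_walks_from_Suc:
  assumes "v \<in> pverts G"
  shows "(\<Sum>p \<in> walks_from G v (Suc n). F p) =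
    (\<Sum>p \<in> walks_from G v n. \<Sum>e \<in> out_arcs G (walk_end v p). F (p @ [e]))"
  unfolding walks_from_Suc
  by (subst sum.reindex[OF inj_on_snoc], subst sum.Sigma)
    (auto simp: finite_walks_from assms finite_out_arcs walk_end_in_pverts intro!: sum.cong)

lemma sum_nb_walks_Suc:
  assumes "v \<in> pverts G"
  shows "(\<Sum>p \<in> nb_walks v (Suc n). F p) =
    (\<Sum>p \<in> nb_walks v n. \<Sum>e \<in> nb_exts v p. F (p @ [e]))"
  unfolding nb_walks_Suc
  by (subst sum.reindex[OF inj_on_snoc], subst sum.Sigma)
    (auto simp: finite_nb_walks assms finite_nb_exts intro!: sum.cong)

lemma nb_sum_eq: "nb_sum G v f n = (\<Sum>p \<in> nb_walks v n. f (walk_end v p))"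
  by (simp add: nb_sum_def nb_walks_def)

lemma walk_sum_eq: "walk_sum G v f n = (\<Sum>p \<in> walks_from G v n. f (walk_end v p))"
  by (simp add: walk_sum_def)

lemma nb_sum_nonneg:
  assumes "\<And>x. x \<in> pverts G \<Longrightarrow> 0 \<le> f x"
  shows "0 \<le> nb_sum G v f n"
  unfolding nb_sum_eq
  by (rule sum_nonneg) (auto simp: nb_walks_def intro!: assms walk_end_in_pverts)

lemma nb_sum_0: "v \<in> pverts G \<Longrightarrow> nb_sum G v f 0 = f v"
  by (simp add: nb_sum_eq nb_walks_0)

lemma nb_sum_Suc:
  "v \<in> pverts G \<Longrightarrow>
    nb_sum G v f (Suc n) = (\<Sum>p \<in> nb_walks v n. \<Sum>e \<in> nb_exts v p. f (snd e))"
  by (simp add: nb_sum_eq sum_nb_walks_Suc walk_end_snoc)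

lemma walk_sum_0: "v \<in> pverts G \<Longrightarrow> walk_sum G v f 0 = f v"
  by (simp add: walk_sum_eq walks_from_0)

lemma walk_sum_Suc: "v \<in> pverts G \<Longrightarrow> walk_sum G v f (Suc n) = walk_sum G v (adj f) n"
  by (simp add: walk_sum_eq sum_walks_from_Suc walk_end_snoc adj_def)

lemma nb_sum_adj_0: "v \<in> pverts G \<Longrightarrow> nb_sum G v (adj f) 0 = nb_sum G v f 1"
  by (simp add: nb_sum_0 nb_sum_Suc nb_walks_0 nb_exts_def adj_def out_arcs_def)

lemma swap_last_in_out_arcs:
  assumes "p @ [e] \<in> walks_from G v n"
  shows "prod.swap e \<in> out_arcs G (snd e)"
  using assms by (auto simp: walks_from_def awalk_def dest: swap_arc)

text \<open>
  A step from the end of \<open>p @ [e]\<close> either extends this walk without backtracking or traverses \<open>e\<close>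
  backwards and ends where \<open>p\<close> does. Steps of the second kind contribute the value at the end of
  \<open>p\<close> once for every extension \<open>e\<close> of \<open>p\<close>.
\<close>

lemma nb_sum_adj_Suc:
  assumes v: "v \<in> pverts G"
    and card: "\<And>p. p \<in> nb_walks v n \<Longrightarrow> real (card (nb_exts v p)) = c"
  shows "nb_sum G v (adj f) (Suc n) = nb_sum G v f (Suc (Suc n)) + c * nb_sum G v f n"
proof -
  have adj: "adj f (snd e) = (\<Sum>e' \<in> nb_exts v (p @ [e]). f (snd e')) + f (walk_end v p)"
    if "p \<in> nb_walks v n" "e \<in> nb_exts v p" for p e
  proof -
    have p: "p @ [e] \<in> walks_from G v (Suc n)"
      using that by (auto simp: nb_walks_def nb_exts_def snoc_in_walks_from)
    have "out_arcs G (snd e) = insert (prod.swap e) (nb_exts v (p @ [e]))"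
      using swap_last_in_out_arcs[OF p] by (auto simp: nb_exts_def walk_end_snoc)
    moreover have "finite (out_arcs G (snd e))"
      using walk_end_in_pverts[OF p] by (auto simp: walk_end_snoc intro: finite_out_arcs)
    moreover have "prod.swap e \<notin> nb_exts v (p @ [e])" by (simp add: nb_exts_def)
    moreover have "snd (prod.swap e) = walk_end v p" using that by (simp add: nb_exts_def)
    ultimately show ?thesis by (simp add: adj_def)
  qed
  have "nb_sum G v (adj f) (Suc n) = (\<Sum>p \<in> nb_walks v n. \<Sum>e \<in> nb_exts v p.
      (\<Sum>e' \<in> nb_exts v (p @ [e]). f (snd e')) + f (walk_end v p))"
    unfolding nb_sum_Suc[OF v] by (intro sum.cong refl adj)
  also have "\<dots> = nb_sum G v f (Suc (Suc n)) +
      (\<Sum>p \<in> nb_walks v n. real (card (nb_exts v p)) * f (walk_end v p))"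
    by (simp add: sum.distrib nb_sum_Suc sum_nb_walks_Suc v)
  also have "(\<Sum>p \<in> nb_walks v n. real (card (nb_exts v p)) * f (walk_end v p)) = c * nb_sum G v f n"
    by (simp add: nb_sum_eq sum_distrib_left card)
  finally show ?thesis .
qed

lemma card_nb_exts:
  assumes "p \<in> nb_walks v n"
  shows "card (nb_exts v p) = out_degree G (walk_end v p) - (if n = 0 then 0 else 1)"
proof (cases n)
  case 0
  then have "p = []" using assms by (simp add: nb_walks_def walks_from_def)
  then show ?thesis using 0 by (simp add: nb_exts_def out_degree_def out_arcs_def)
next
  case (Suc m)
  then have "p \<noteq> []" using assms by (auto simp: nb_walks_def walks_from_def)
  then obtain p' e where p: "p = p' @ [e]" by (cases p rule: rev_cases) auto
  have "p \<in> walks_from G v n" using assms by (simp add: nb_walks_def)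
  then have fin: "finite (out_arcs G (snd e))" and swap: "prod.swap e \<in> out_arcs G (snd e)"
    using swap_last_in_out_arcs[of p' e v n] walk_end_in_pverts[of p v n]
    by (auto simp: p walk_end_snoc intro: finite_out_arcs)
  have "nb_exts v p = out_arcs G (snd e) - {prod.swap e}"
    by (auto simp: nb_exts_def p walk_end_snoc)
  then show ?thesis using fin swap Suc by (simp add: p walk_end_snoc out_degree_def)
qed

end

section \<open>Biregular graphs\<close>

context locally_finite_graph
begin

lemma walk_end_parity:
  assumes bip: "\<forall>(x, y) \<in> parcs G. x \<in> U \<and> y \<in> W \<or> x \<in> W \<and> y \<in> U"
    and disj: "U \<inter> W = {}" and v: "v \<in> U" "v \<in> pverts G"
  shows "p \<in> walks_from G v n \<Longrightarrow> walk_end v p \<in> (if even n then U else W)"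
proof (induction n arbitrary: p)
  case 0
  then show ?case using v by (simp add: walks_from_0)
next
  case (Suc n)
  then obtain p' e where p: "p = p' @ [e]" and p': "p' \<in> walks_from G v n"
    and e: "e \<in> out_arcs G (walk_end v p')"
    by (auto simp: walks_from_Suc)
  have "(walk_end v p', snd e) \<in> parcs G" using e by (cases e) auto
  with bip Suc.IH[OF p'] disj have "snd e \<in> (if even n then W else U)"
    by (auto split: if_splits)
  then show ?case by (auto simp: p walk_end_snoc split: if_splits)
qed

text \<open>
  Here \<open>A\<close> is any operator on sequences that intertwines with the adjacency operator; evaluation
  at \<open>0\<close> recovers \<open>f v\<close>, since the empty walk is the only one of length \<open>0\<close>.
\<close>

lemma walk_sum_eq_iterate:
  assumes "v \<in> pverts G" and "\<And>f. nb_sum G v (adj f) = A (nb_sum G v f)"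
  shows "walk_sum G v f r = (A ^^ r) (nb_sum G v f) 0"
proof (induction r arbitrary: f)
  case 0
  then show ?case by (simp add: assms(1) walk_sum_0 nb_sum_0)
next
  case (Suc r)
  then show ?case by (simp add: walk_sum_Suc assms funpow_swap1)
qed

lemma nb_sum_adj_biregular:
  assumes bip: "\<forall>(x, y) \<in> parcs G. x \<in> U \<and> y \<in> W \<or> x \<in> W \<and> y \<in> U"
    and disj: "U \<inter> W = {}" and v: "v \<in> U" "v \<in> pverts G"
    and deg_U: "\<forall>x\<in>U. out_degree G x = k" and deg_W: "\<forall>x\<in>W. out_degree G x = l"
    and "2 \<le> k" "2 \<le> l"
  shows "nb_sum G v (adj f) = radial.radial_adj (real k - 1) (real l - 1) (nb_sum G v f)"
proof
  fix n
  interpret radial "real k - 1" "real l - 1"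
    using assms by unfold_locales auto
  show "nb_sum G v (adj f) n = radial_adj (nb_sum G v f) n"
  proof (cases n)
    case 0
    then show ?thesis by (simp add: radial_adj_def down_weight_def nb_sum_adj_0 v)
  next
    case (Suc m)
    have "real (card (nb_exts v p)) = down_weight (Suc m)" if p: "p \<in> nb_walks v m" for p
    proof -
      have "p \<in> walks_from G v m" using p by (simp add: nb_walks_def)
      then have "walk_end v p \<in> (if even m then U else W)"
        by (rule walk_end_parity[OF bip disj v])
      then have "out_degree G (walk_end v p) = (if even m then k else l)"
        using deg_U deg_W by (simp split: if_splits)
      then show ?thesis
        using card_nb_exts[OF p] assms by (auto simp: down_weight_def)
    qed
    then show ?thesis unfolding Suc by (simp add: nb_sum_adj_Suc v radial_adj_def)
  qed
qed

lemma walk_sum_pos: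
  assumes f: "\<And>x. x \<in> pverts G \<Longrightarrow> 0 \<le> f x" and v: "v \<in> pverts G"
    and p: "awalk v p x" and "f x \<noteq> 0"
  shows "0 < walk_sum G v f (length p)"
proof -
  have x: "walk_end v p = x" "x \<in> pverts G" using p by auto
  have "0 < f x" using f[OF x(2)] assms(4) by simp
  moreover have "f (walk_end v p) \<le> (\<Sum>p \<in> walks_from G v (length p). f (walk_end v p))"
  proof (rule member_le_sum)
    show "p \<in> walks_from G v (length p)" using p by (auto simp: walks_from_def)
  qed (auto intro!: f walk_end_in_pverts finite_walks_from v)
  ultimately show ?thesis by (simp add: walk_sum_eq x)
qed

lemma connected_imp_awalk:
  assumes "Digraph_Component.connected G" and "x \<in> pverts G" and "y \<in> pverts G"
  shows "\<exists>p. awalk x p y"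
  using assms reachable_mk_symmetric_eq[OF pair_sym_arcs, of x y]
  by (simp add: connected_def strongly_connected_def reachable_awalk)

text \<open>
  The sequence of non-backtracking sums is not identically zero: connectedness gives a walk from
  \<open>v\<close> to a vertex where \<open>f\<close> is positive, so some sum over all walks is positive, and these sums
  are iterates of a linear operator on the sequence of non-backtracking sums.
\<close>

lemma biregular_walk_growth:
  assumes conn: "Digraph_Component.connected G"
    and bip: "\<forall>(x, y) \<in> parcs G. x \<in> U \<and> y \<in> W \<or> x \<in> W \<and> y \<in> U"
    and disj: "U \<inter> W = {}" and v: "v \<in> U" "v \<in> pverts G"
    and deg: "\<forall>x\<in>U. out_degree G x = k" "\<forall>x\<in>W. out_degree G x = l"
    and kl: "2 \<le> k" "2 \<le> l"
    and f: "\<forall>x\<in>pverts G. 0 \<le> f x" "\<exists>x\<in>pverts G. f x \<noteq> 0"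
  defines "\<alpha> \<equiv> nb_growth G v f" and "\<beta> \<equiv> walk_growth G v f"
  shows "(\<alpha> \<le> ereal (root 4 (real k - 1) * root 4 (real l - 1)) \<longrightarrow>
            \<beta> = ereal (sqrt (real k - 1) + sqrt (real l - 1))) \<and>
         (\<alpha> \<ge> ereal (root 4 (real k - 1) * root 4 (real l - 1)) \<longrightarrow>
            \<beta> = ereal_sqrt (\<alpha> + ereal (real k - 1) / \<alpha>) * ereal_sqrt (\<alpha> + ereal (real l - 1) / \<alpha>))"
proof -
  interpret radial "real k - 1" "real l - 1"
    using kl by unfold_locales auto
  have iterate: "walk_sum G v f r = (radial_adj ^^ r) (nb_sum G v f) 0" for r
    by (rule walk_sum_eq_iterate[OF v(2) nb_sum_adj_biregular[OF bip disj v deg kl]])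
  obtain x p where "awalk v p x" "f x \<noteq> 0"
    using f(2) connected_imp_awalk[OF conn v(2)] by blast
  then have "0 < walk_sum G v f (length p)" using f(1) v(2) by (intro walk_sum_pos) auto
  moreover have "(radial_adj ^^ r) (\<lambda>n. 0) = (\<lambda>n. 0)" for r
    by (induction r) (auto simp: radial_adj_zero)
  ultimately have "nb_sum G v f \<noteq> (\<lambda>n. 0)" unfolding iterate by force
  then obtain m where "nb_sum G v f m \<noteq> 0" by blast
  then show ?thesis
    using growth_radial_adj_iterates[of "nb_sum G v f" m] nb_sum_nonneg[of f v] f(1)
    unfolding \<alpha>_def \<beta>_def nb_growth_def walk_growth_def growth_def iterate by blast
qed

end

theorem theorem1p2:
  fixes G :: "'a pair_pre_digraph" and v :: 'a and f :: "'a \<Rightarrow> real" and k l :: nat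
    and \<alpha> \<beta> :: ereal
  assumes "2 \<le> k" and "2 \<le> l"
    and "biregular_tree k l G"
    and "v \<in> pverts G"
    and "\<forall>x\<in>pverts G. 0 \<le> f x"
    and "\<exists>x\<in>pverts G. f x \<noteq> 0"
  defines "\<alpha> \<equiv> nb_growth G v f" and "\<beta> \<equiv> walk_growth G v f"
  shows "(\<alpha> \<le> ereal (root 4 (real k - 1) * root 4 (real l - 1)) \<longrightarrow>
            \<beta> = ereal (sqrt (real k - 1) + sqrt (real l - 1))) \<and>
         (\<alpha> \<ge> ereal (root 4 (real k - 1) * root 4 (real l - 1)) \<longrightarrow>
            \<beta> = ereal_sqrt (\<alpha> + ereal (real k - 1) / \<alpha>) * ereal_sqrt (\<alpha> + ereal (real l - 1) / \<alpha>))"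
proof -
  obtain U W where UW: "pverts G = U \<union> W" and disj: "U \<inter> W = {}"
    and bip: "\<forall>(x, y) \<in> parcs G. x \<in> U \<and> y \<in> W \<or> x \<in> W \<and> y \<in> U"
    and deg_U: "\<forall>x\<in>U. out_degree (with_proj G) x = k"
    and deg_W: "\<forall>x\<in>W. out_degree (with_proj G) x = l"
    using assms(3) unfolding biregular_tree_def by blast
  have tree: "pair_bidirected_digraph G" and conn: "Digraph_Component.connected (with_proj G)"
    using assms(3) by (auto simp: biregular_tree_def undirected_tree_def)
  interpret locally_finite_graph G
  proof (intro locally_finite_graph.intro tree locally_finite_graph_axioms.intro)
    fix x assume "x \<in> pverts G"
    then have "0 < out_degree (with_proj G) x" using UW deg_U deg_W assms(1,2) by auto
    then show "finite (out_arcs (with_proj G) x)"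
      unfolding out_degree_def by (rule card_ge_0_finite)
  qed
  show ?thesis
  proof (cases "v \<in> U")
    case True
    then show ?thesis
      unfolding \<alpha>_def \<beta>_def by (intro biregular_walk_growth[OF conn bip disj] assms deg_U deg_W)
  next
    case False
    then have "v \<in> W" using assms(4) UW by blast
    have bip': "\<forall>(x, y) \<in> parcs G. x \<in> W \<and> y \<in> U \<or> x \<in> U \<and> y \<in> W"
      using bip by auto
    have disj': "W \<inter> U = {}" using disj by blast
    \<comment> \<open>The formula is symmetric in \<open>k\<close> and \<open>l\<close>, so the two sides may exchange their roles.\<close>
    note swapped = biregular_walk_growth[OF conn bip' disj' \<open>v \<in> W\<close> assms(4) deg_W deg_U assms(2,1,5,6)]
    show ?thesis
      unfolding \<alpha>_def \<beta>_def
      using swapped by (simp only: mult.commute[of "root 4 (real l - 1)"]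
          add.commute[of "sqrt (real l - 1)"]
          mult.commute[of "ereal_sqrt (nb_growth G v f + ereal (real l - 1) / nb_growth G v f)"])
  qed
qed

end
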